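(* Let $L$ be an indexed language over an alphabet $A$ and let $B\subseteq A$. If $B$ is rare in $L$, then $B$ is nonfrequent in $L$.
   Context: Indexed languages are the languages generated by indexed grammars (Aho's grammars in which nonterminals carry stacks that can be pushed, popped and copied). For a word $w$ and $B\subseteq A$, $\#_B(w)$ is the number of occurrences in $w$ of symbols from $B$. $B$ is nonfrequent in $L$ if there is a constant $c_B$ with $\#_B(w)\le c_B$ for all $w\in L$, and frequent otherwise. $B$ is rare in $L$ if for every $k\ge1$ there is $n_k\ge1$ such that for all $w\in L$ with $\#_B(w)\ge n_k$, any two distinct occurrences in $w$ of symbols from $B$ are at positions whose difference is at least $k$. *)

theory Defs
  imports Main
begin

text \<open>Indexed grammars (Aho). A symbol is a terminal, or a nonterminal carrying a
  stack of flags (head of the list = top of the stack). In a right-hand side the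
  list attached to a nonterminal is the string of flags pushed on top of the
  (inherited) stack.\<close>

datatype ('n, 'f, 't) isym = Tm 't | Nt 'n "'f list"

text \<open>A production (A, fo, rhs): if fo = None, A with any stack rewrites to rhs, the
  stack being copied to every nonterminal of rhs (below the pushed flags);
  if fo = Some f, the flag f is popped from the top of the stack first.\<close>

type_synonym ('n, 'f, 't) iprod = "'n \<times> 'f option \<times> ('n, 'f, 't) isym list"

fun inst_stack :: "'f list \<Rightarrow> ('n, 'f, 't) isym \<Rightarrow> ('n, 'f, 't) isym" where
  "inst_stack \<sigma> (Tm a) = Tm a"
| "inst_stack \<sigma> (Nt B \<gamma>) = Nt B (\<gamma> @ \<sigma>)"

definition istep :: "('n, 'f, 't) iprod set \<Rightarrow> ('n, 'f, 't) isym list \<Rightarrow> ('n, 'f, 't) isym list \<Rightarrow> bool" where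
  "istep P u v \<longleftrightarrow> (\<exists>l r A fo rhs \<sigma>. (A, fo, rhs) \<in> P \<and>
      u = l @ [Nt A (case fo of None \<Rightarrow> \<sigma> | Some f \<Rightarrow> f # \<sigma>)] @ r \<and>
      v = l @ map (inst_stack \<sigma>) rhs @ r)"

definition ilang :: "('n, 'f, 't) iprod set \<Rightarrow> 'n \<Rightarrow> 't list set" where
  "ilang P S = {w. (istep P)\<^sup>*\<^sup>* [Nt S []] (map Tm w)}"

definition indexed_language :: "'t list set \<Rightarrow> bool" where
  "indexed_language L \<longleftrightarrow>
     (\<exists>(P :: (nat, nat, 't) iprod set) S. finite P \<and> L = ilang P S)"

definition count_in :: "'t set \<Rightarrow> 't list \<Rightarrow> nat" where
  "count_in B w = length (filter (\<lambda>x. x \<in> B) w)"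

definition nonfrequent :: "'t set \<Rightarrow> 't list set \<Rightarrow> bool" where
  "nonfrequent B L \<longleftrightarrow> (\<exists>c. \<forall>w\<in>L. count_in B w \<le> c)"

definition rare :: "'t set \<Rightarrow> 't list set \<Rightarrow> bool" where
  "rare B L \<longleftrightarrow> (\<forall>k\<ge>1. \<exists>n\<ge>1. \<forall>w\<in>L. count_in B w \<ge> n \<longrightarrow>
      (\<forall>i j. i < j \<and> j < length w \<and> w ! i \<in> B \<and> w ! j \<in> B \<longrightarrow> j - i \<ge> k))"

end

theory Submission
  imports Defs
begin

text \<open>Classify stacks by the nonterminals that derive a terminal word, or a terminal word with a
  letter of \<open>B\<close>, from them; this type is preserved by pushing flags, and there are finitely many.
  A word with many letters of \<open>B\<close> has a derivation tree with a path on which many steps branch off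
  a subtree contributing to \<open>B\<close>. The path is a run of a pushdown automaton, so a run of this kind
  that is long enough contains one nested in another with the same nonterminals, flag and stack
  type, with a branching in the difference. It is pumped as in a context-free language:
  \<open>A[f\<sigma>] \<Rightarrow> u A[f\<gamma>\<sigma>] v\<close> and \<open>Z[\<gamma>\<sigma>] \<Rightarrow> x Z[\<sigma>] y\<close>. The side branches at level \<open>n\<close> see the stack
  \<open>\<gamma>\<^sup>n\<sigma>\<close>, and may get arbitrarily long with \<open>n\<close>, but those at levels 0 and 1 are neighbours and can
  be kept fixed. This gives words with arbitrarily many letters of \<open>B\<close> and two of them at a bounded
  distance, so \<open>B\<close> is not rare.\<close>

section \<open>Rewriting steps and instantiation of stacks\<close>

definition flags :: "'f option \<Rightarrow> 'f list" where
  "flags fo = (case fo of None \<Rightarrow> [] | Some f \<Rightarrow> [f])"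

lemma flags_simps [simp]: "flags None = []" "flags (Some f) = [f]"
  by (simp_all add: flags_def)

lemma istep_iff:
  "istep P u v \<longleftrightarrow> (\<exists>l r A fo rhs \<sigma>. (A, fo, rhs) \<in> P \<and>
     u = l @ [Nt A (flags fo @ \<sigma>)] @ r \<and> v = l @ map (inst_stack \<sigma>) rhs @ r)"
proof -
  have "(case fo of None \<Rightarrow> \<sigma> | Some f \<Rightarrow> f # \<sigma>) = flags fo @ \<sigma>" for fo :: "'b option" and \<sigma>
    by (cases fo) auto
  then show ?thesis
    unfolding istep_def by simp
qed

lemma inst_inst [simp]: "inst_stack \<sigma> (inst_stack \<gamma> s) = inst_stack (\<gamma> @ \<sigma>) s"
  by (cases s) auto

lemma inst_comp [simp]: "inst_stack \<sigma> \<circ> inst_stack \<gamma> = inst_stack (\<gamma> @ \<sigma>)"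
  by auto

lemma inst_Nil [simp]: "inst_stack [] = id"
proof
  show "inst_stack [] s = id s" for s :: "('a, 'b, 'c) isym"
    by (cases s) auto
qed

lemma flags_append_cases:
  assumes "\<gamma> @ \<sigma> = flags fo @ \<tau>" "\<gamma> \<noteq> []"
  obtains \<gamma>' where "\<gamma> = flags fo @ \<gamma>'" "\<tau> = \<gamma>' @ \<sigma>"
  using assms by (cases fo; cases \<gamma>) auto

lemma istep_prod: "(A, fo, rhs) \<in> P \<Longrightarrow> istep P [Nt A (flags fo @ \<sigma>)] (map (inst_stack \<sigma>) rhs)"
  unfolding istep_iff by fastforce

lemma istep_append: "istep P u v \<Longrightarrow> istep P (l @ u @ r) (l @ v @ r)"
  unfolding istep_iff by (metis append.assoc)

lemma istep_inst:
  assumes "istep P u v"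
  shows "istep P (map (inst_stack \<sigma>) u) (map (inst_stack \<sigma>) v)"
proof -
  from assms obtain l r A fo rhs \<tau> where "(A, fo, rhs) \<in> P"
    and uv: "u = l @ [Nt A (flags fo @ \<tau>)] @ r" "v = l @ map (inst_stack \<tau>) rhs @ r"
    unfolding istep_iff by blast
  from istep_append[OF istep_prod[OF this(1)], of "map (inst_stack \<sigma>) l" "\<tau> @ \<sigma>" "map (inst_stack \<sigma>) r"]
  show ?thesis
    by (simp add: uv)
qed

lemma isteps_append: "(istep P)\<^sup>*\<^sup>* u v \<Longrightarrow> (istep P)\<^sup>*\<^sup>* (l @ u @ r) (l @ v @ r)"
  by (induction rule: rtranclp_induct) (auto intro: rtranclp.rtrancl_into_rtrancl istep_append)

lemma isteps_inst:
  "(istep P)\<^sup>*\<^sup>* u v \<Longrightarrow> (istep P)\<^sup>*\<^sup>* (map (inst_stack \<sigma>) u) (map (inst_stack \<sigma>) v)"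
  by (induction rule: rtranclp_induct) (auto intro: rtranclp.rtrancl_into_rtrancl istep_inst)

section \<open>Derivation trees\<close>

text \<open>Big-step form of \<open>istep\<close>: each symbol has its own subderivation, so
  induction follows the derivation tree instead of an interleaved sequence of steps.\<close>

inductive der :: "('n, 'f, 't) iprod set \<Rightarrow> ('n, 'f, 't) isym list \<Rightarrow> 't list \<Rightarrow> bool" for P where
  Nil: "der P [] []"
| Tm: "der P u w \<Longrightarrow> der P (Tm a # u) (a # w)"
| Nt: "(A, fo, rhs) \<in> P \<Longrightarrow> der P (map (inst_stack \<sigma>) rhs) v \<Longrightarrow> der P u w \<Longrightarrow>
    der P (Nt A (flags fo @ \<sigma>) # u) (v @ w)"

lemma der_append: "der P u v \<Longrightarrow> der P u' v' \<Longrightarrow> der P (u @ u') (v @ v')"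
  by (induction rule: der.induct) (auto intro: der.intros)

lemma der_appendE:
  assumes "der P (u @ u') w"
  obtains v v' where "w = v @ v'" "der P u v" "der P u' v'"
proof -
  have "\<exists>v v'. w = v @ v' \<and> der P u v \<and> der P u' v'"
    using assms
  proof (induction u arbitrary: w)
    case Nil
    then show ?case by (auto intro: der.Nil)
  next
    case (Cons s u)
    from Cons.prems have "der P (s # (u @ u')) w" by simp
    then show ?case
    proof cases
      case (Tm w' a)
      with Cons.IH[of w'] show ?thesis
        by (metis append_Cons der.Tm)
    next
      case (Nt A fo rhs \<sigma> v w')
      with Cons.IH[of w'] show ?thesis
        by (metis append.assoc der.Nt)
    qed
  qed
  then show ?thesis using that by blast
qed

lemma der_map_Tm: "der P (map Tm w) w"
  by (induction w) (auto intro: der.intros)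

lemma der_istep:
  assumes "istep P u v" "der P v w"
  shows "der P u w"
proof -
  from assms(1) obtain l r A fo rhs \<sigma> where p: "(A, fo, rhs) \<in> P"
    and u: "u = l @ [Nt A (flags fo @ \<sigma>)] @ r" and v: "v = l @ map (inst_stack \<sigma>) rhs @ r"
    unfolding istep_iff by blast
  from assms(2)[unfolded v] obtain w1 w2 w3 where "w = w1 @ w2 @ w3" "der P l w1"
    "der P (map (inst_stack \<sigma>) rhs) w2" "der P r w3"
    by (metis der_appendE)
  then show ?thesis
    unfolding u using der_append der.Nt[OF p] by fastforce
qed

lemma der_isteps: "(istep P)\<^sup>*\<^sup>* u v \<Longrightarrow> der P v w \<Longrightarrow> der P u w"
  by (induction rule: converse_rtranclp_induct) (auto intro: der_istep)

lemma isteps_der: "der P u w \<Longrightarrow> (istep P)\<^sup>*\<^sup>* u (map Tm w)"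
proof (induction rule: der.induct)
  case (Tm u w a)
  from isteps_append[OF Tm.IH, of "[Tm a]" "[]"] show ?case by simp
next
  case (Nt A fo rhs \<sigma> v u w)
  from istep_append[OF istep_prod[OF Nt.hyps(1)], of "[]" \<sigma> u]
  have "istep P (Nt A (flags fo @ \<sigma>) # u) (map (inst_stack \<sigma>) rhs @ u)" by simp
  also from isteps_append[OF Nt.IH(1), of "[]" u]
  have "(istep P)\<^sup>*\<^sup>* (map (inst_stack \<sigma>) rhs @ u) (map Tm v @ u)" by simp
  also from isteps_append[OF Nt.IH(2), of "map Tm v" "[]"]
  have "(istep P)\<^sup>*\<^sup>* (map Tm v @ u) (map Tm v @ map Tm w)" by simp
  finally show ?case by simp
qed simp

lemma ilang_iff_der: "w \<in> ilang P S \<longleftrightarrow> der P [Nt S []] w"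
  unfolding ilang_def using isteps_der der_isteps[OF _ der_map_Tm] by blast

lemma der_inst: "der P u w \<Longrightarrow> der P (map (inst_stack \<sigma>) u) w"
  using isteps_inst[OF isteps_der, of P u w \<sigma>] der_isteps[OF _ der_map_Tm]
  by (force simp: comp_def)

text \<open>Only a production popping \<open>b\<close> could notice it at the bottom; as there is
  none, every step can be repeated on the part above.\<close>

lemma der_drop_bottom:
  assumes "\<And>A rhs. (A, Some b, rhs) \<notin> P" "der P (map (inst_stack [b]) u) w"
  shows "der P u w"
  using assms(2)
proof (induction "map (inst_stack [b]) u" w arbitrary: u rule: der.induct)
  case Nil
  then show ?case by (auto intro: der.Nil)
next
  case (Tm v w a)
  from Tm.hyps(3) obtain s u' where u: "u = s # u'" "inst_stack [b] s = Tm a" "v = map (inst_stack [b]) u'"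
    by auto
  moreover from u(2) have "s = Tm a" by (cases s) auto
  ultimately show ?case using Tm.hyps(2) by (auto intro: der.Tm)
next
  case (Nt A fo rhs \<sigma> v x w)
  from Nt.hyps(6) obtain s u' where u: "u = s # u'" "inst_stack [b] s = Nt A (flags fo @ \<sigma>)" "x = map (inst_stack [b]) u'"
    by auto
  then obtain \<gamma> where s: "s = Nt A \<gamma>" "\<gamma> @ [b] = flags fo @ \<sigma>" by (cases s) auto
  have "\<exists>\<gamma>'. \<gamma> = flags fo @ \<gamma>' \<and> \<sigma> = \<gamma>' @ [b]"
    using s(2) assms(1) Nt.hyps(1) by (cases fo; cases \<gamma>) auto
  then obtain \<gamma>' where g: "\<gamma> = flags fo @ \<gamma>'" "\<sigma> = \<gamma>' @ [b]" by blast
  have "der P (map (inst_stack \<gamma>') rhs) v" by (rule Nt.hyps(3)) (simp add: g)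
  then show ?case
    unfolding u(1) s(1) g(1) using Nt.hyps(1) Nt.hyps(5)[OF u(3)] by (intro der.Nt)
qed

section \<open>Criteria for not being rare\<close>

lemma count_in_append [simp]: "count_in B (u @ v) = count_in B u + count_in B v"
  by (simp add: count_in_def)

lemma count_in_pos_iff: "count_in B w > 0 \<longleftrightarrow> set w \<inter> B \<noteq> {}"
  by (auto simp: count_in_def filter_empty_conv)

text \<open>Adjacent blocks \<open>p\<close> and \<open>q\<close> of total length at most
  \<open>C\<close> hold two letters of \<open>B\<close> at difference below \<open>C\<close>, while
  the number of letters is unbounded; this refutes rarity for \<open>k = Suc C\<close>.\<close>

lemma not_rareI:
  assumes "\<And>n. \<exists>a p q c. a @ p @ q @ c \<in> L \<and> set p \<inter> B \<noteq> {} \<and> set q \<inter> B \<noteq> {} \<and>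
    length p + length q \<le> C \<and> n \<le> count_in B (a @ p @ q @ c)"
  shows "\<not> rare B L"
proof
  assume "rare B L"
  then obtain n where n: "\<And>w i j. w \<in> L \<Longrightarrow> n \<le> count_in B w \<Longrightarrow> i < j \<Longrightarrow> j < length w \<Longrightarrow>
      w ! i \<in> B \<Longrightarrow> w ! j \<in> B \<Longrightarrow> Suc C \<le> j - i"
    unfolding rare_def by (metis Suc_eq_plus1 le_add2)
  obtain a p q c where w: "a @ p @ q @ c \<in> L" "set p \<inter> B \<noteq> {}" "set q \<inter> B \<noteq> {}"
    "length p + length q \<le> C" "n \<le> count_in B (a @ p @ q @ c)"
    using assms[of n] by blast
  obtain i where i: "i < length p" "p ! i \<in> B"
    using w(2) by (auto simp: in_set_conv_nth)
  obtain j where j: "j < length q" "q ! j \<in> B"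
    using w(3) by (auto simp: in_set_conv_nth)
  have "Suc C \<le> (length a + length p + j) - (length a + i)"
    by (rule n[OF w(1,5)]) (use i j in \<open>auto simp: nth_append\<close>)
  then show False using i j w(4) by auto
qed

lemma count_in_concat_ge:
  "(\<And>x. x \<in> set xs \<Longrightarrow> set (X x) \<inter> B \<noteq> {}) \<Longrightarrow> length xs \<le> count_in B (concat (map X xs))"
proof (induction xs)
  case (Cons a xs)
  then have "0 < count_in B (X a)" by (simp add: count_in_pos_iff)
  with Cons show ?case by fastforce
qed simp

text \<open>The lengths of the blocks may be unbounded, but \<open>X 0\<close> and
  \<open>X 1\<close> are neighbours and do not depend on \<open>N\<close>. All blocks together
  supply the required number of letters.\<close>

lemma not_rare_upto:
  assumes B: "\<And>n. set (X n) \<inter> B \<noteq> {}"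
    and L: "\<And>N :: nat. \<exists>a c. a @ concat (map X [0..<N]) @ c \<in> L"
  shows "\<not> rare B L"
proof (rule not_rareI[where C = "length (X 0) + length (X 1)"])
  fix n
  obtain a c where ac: "a @ concat (map X [0..<Suc (Suc n)]) @ c \<in> L" using L by blast
  have eq: "concat (map X [0..<Suc (Suc n)]) = X 0 @ X 1 @ concat (map X [2..<Suc (Suc n)])"
    by (simp add: upt_conv_Cons numeral_2_eq_2 del: upt_Suc)
  have "n \<le> count_in B (concat (map X [0..<Suc (Suc n)]))"
    using count_in_concat_ge[of "[0..<Suc (Suc n)]" X B] B by fastforce
  then show "\<exists>a p q c. a @ p @ q @ c \<in> L \<and> set p \<inter> B \<noteq> {} \<and> set q \<inter> B \<noteq> {} \<and>
      length p + length q \<le> length (X 0) + length (X 1) \<and> n \<le> count_in B (a @ p @ q @ c)"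
    using ac B unfolding eq
    by (intro exI[of _ a] exI[of _ "X 0"] exI[of _ "X 1"] exI[of _ "concat (map X [2..<Suc (Suc n)]) @ c"])
      (simp add: ac_simps)
qed

lemma not_rare_downto:
  assumes B: "\<And>n. set (X n) \<inter> B \<noteq> {}"
    and L: "\<And>N :: nat. \<exists>a c. a @ concat (map X (rev [0..<N])) @ c \<in> L"
  shows "\<not> rare B L"
proof (rule not_rareI[where C = "length (X 0) + length (X 1)"])
  fix n
  obtain a c where ac: "a @ concat (map X (rev [0..<Suc (Suc n)])) @ c \<in> L" using L by blast
  have eq: "concat (map X (rev [0..<Suc (Suc n)])) = concat (map X (rev [2..<Suc (Suc n)])) @ X 1 @ X 0"
    by (simp add: upt_conv_Cons numeral_2_eq_2 del: upt_Suc)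
  have "n \<le> count_in B (concat (map X (rev [0..<Suc (Suc n)])))"
    using count_in_concat_ge[of "rev [0..<Suc (Suc n)]" X B] B by fastforce
  then show "\<exists>a p q c. a @ p @ q @ c \<in> L \<and> set p \<inter> B \<noteq> {} \<and> set q \<inter> B \<noteq> {} \<and>
      length p + length q \<le> length (X 0) + length (X 1) \<and> n \<le> count_in B (a @ p @ q @ c)"
    using ac B unfolding eq
    by (intro exI[of _ "a @ concat (map X (rev [2..<Suc (Suc n)]))"] exI[of _ "X 1"] exI[of _ "X 0"] exI[of _ c])
      (simp add: ac_simps)
qed

section \<open>Stack types\<close>

locale marked_grammar =
  fixes P :: "('n, 'f, 't) iprod set" and B :: "'t set"
begin

definition yields :: "bool \<Rightarrow> ('n, 'f, 't) isym list \<Rightarrow> bool" where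
  "yields b u \<longleftrightarrow> (\<exists>w. der P u w \<and> (b \<longrightarrow> set w \<inter> B \<noteq> {}))"

abbreviation yields_on :: "bool \<Rightarrow> 'f list \<Rightarrow> ('n, 'f, 't) isym list \<Rightarrow> bool" where
  "yields_on b \<sigma> u \<equiv> yields b (map (inst_stack \<sigma>) u)"

definition stack_type :: "'f list \<Rightarrow> (bool \<times> 'n) set" where
  "stack_type \<sigma> = {(b, A). yields b [Nt A \<sigma>]}"

lemma yields_append:
  "yields b u \<Longrightarrow> yields c v \<Longrightarrow> (d \<Longrightarrow> b \<or> c) \<Longrightarrow> yields d (u @ v)"
  unfolding yields_def using der_append by fastforce

lemma yields_isteps: "(istep P)\<^sup>*\<^sup>* u v \<Longrightarrow> yields b v \<Longrightarrow> yields b u"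
  unfolding yields_def using der_isteps by blast

text \<open>The derivation is replayed over \<open>\<sigma>'\<close>: while pushed flags remain, the
  same productions apply; once a nonterminal stands on \<open>\<sigma>\<close> itself, equality of
  types supplies a replacement, with a letter of \<open>B\<close> if there was one.\<close>

lemma yields_on_transfer:
  assumes "stack_type \<sigma> = stack_type \<sigma>'" "yields_on b \<sigma> u"
  shows "yields_on b \<sigma>' u"
proof -
  have "\<exists>w'. der P (map (inst_stack \<sigma>') u) w' \<and> (set w \<inter> B \<noteq> {} \<longrightarrow> set w' \<inter> B \<noteq> {})"
    if "der P (map (inst_stack \<sigma>) u) w" for w
    using that
  proof (induction "map (inst_stack \<sigma>) u" w arbitrary: u rule: der.induct)
    case Nil
    then show ?case by (auto intro: der.Nil)
  next
    case (Tm v w a)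
    from Tm.hyps(3) obtain s u' where u: "u = s # u'" "inst_stack \<sigma> s = Tm a" "v = map (inst_stack \<sigma>) u'"
      by auto
    from u(2) have "s = Tm a" by (cases s) auto
    with u(1) Tm.hyps(2)[OF u(3)] show ?case by (force intro: der.Tm)
  next
    case (Nt A fo rhs \<tau> v x w)
    from Nt.hyps(6) obtain s u' where u: "u = s # u'" "inst_stack \<sigma> s = Nt A (flags fo @ \<tau>)" "x = map (inst_stack \<sigma>) u'"
      by auto
    then obtain \<gamma> where s: "s = Nt A \<gamma>" "\<gamma> @ \<sigma> = flags fo @ \<tau>" by (cases s) auto
    obtain w' where w': "der P (map (inst_stack \<sigma>') u') w'" "set w \<inter> B \<noteq> {} \<longrightarrow> set w' \<inter> B \<noteq> {}"
      using Nt.hyps(5)[OF u(3)] by blast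
    have "\<exists>v'. der P [Nt A (\<gamma> @ \<sigma>')] v' \<and> (set v \<inter> B \<noteq> {} \<longrightarrow> set v' \<inter> B \<noteq> {})"
    proof (cases "\<gamma> = []")
      case True
      from der.Nt[OF Nt.hyps(1,2) der.Nil] have "der P [Nt A \<sigma>] v"
        using True s(2) by simp
      then have "(set v \<inter> B \<noteq> {}, A) \<in> stack_type \<sigma>"
        unfolding stack_type_def yields_def by blast
      with assms(1) have "(set v \<inter> B \<noteq> {}, A) \<in> stack_type \<sigma>'" by simp
      then show ?thesis
        unfolding stack_type_def yields_def by (simp add: True)
    next
      case False
      with s(2) obtain \<gamma>' where g: "\<gamma> = flags fo @ \<gamma>'" "\<tau> = \<gamma>' @ \<sigma>"
        by (rule flags_append_cases)
      obtain v' where v': "der P (map (inst_stack (\<gamma>' @ \<sigma>')) rhs) v'"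
        "set v \<inter> B \<noteq> {} \<longrightarrow> set v' \<inter> B \<noteq> {}"
        using Nt.hyps(3)[of "map (inst_stack \<gamma>') rhs"] by (auto simp: g(2))
      from der.Nt[OF Nt.hyps(1) v'(1) der.Nil] v'(2) show ?thesis
        by (auto simp: g(1))
    qed
    then obtain v' where "der P [Nt A (\<gamma> @ \<sigma>')] v'" "set v \<inter> B \<noteq> {} \<longrightarrow> set v' \<inter> B \<noteq> {}"
      by blast
    from der_append[OF this(1) w'(1)] this(2) w'(2) show ?case
      unfolding u(1) s(1) by (intro exI[of _ "v' @ w'"]) auto
  qed
  then show ?thesis
    using assms(2) unfolding yields_def by blast
qed

lemma yields_on_cong: "stack_type \<sigma> = stack_type \<sigma>' \<Longrightarrow> yields_on b \<sigma> u \<longleftrightarrow> yields_on b \<sigma>' u"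
  using yields_on_transfer[of \<sigma> \<sigma>'] yields_on_transfer[of \<sigma>' \<sigma>] by auto

lemma stack_type_append:
  "stack_type \<sigma> = stack_type \<sigma>' \<Longrightarrow> stack_type (\<gamma> @ \<sigma>) = stack_type (\<gamma> @ \<sigma>')"
  unfolding stack_type_def
  using yields_on_cong[of \<sigma> \<sigma>' _ "[Nt _ \<gamma>]"] by (auto simp: stack_type_def)

section \<open>Contexts and pumping\<close>

text \<open>Since the derivation starts from the stack \<open>\<gamma>\<close> alone, it never touches a stack \<open>\<sigma>\<close> placed
  below \<open>\<gamma>\<close>; \<open>\<sigma>\<close> is only needed for terminating the side branches.\<close>

definition ctx :: "bool \<Rightarrow> 'f list \<Rightarrow> 'n \<Rightarrow> 'f list \<Rightarrow> 'n \<Rightarrow> 'f list \<Rightarrow> bool" where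
  "ctx e \<sigma> A \<gamma> A' \<gamma>' \<longleftrightarrow> (\<exists>l r. (istep P)\<^sup>*\<^sup>* [Nt A \<gamma>] (l @ [Nt A' \<gamma>'] @ r) \<and>
     yields_on False \<sigma> l \<and> yields_on False \<sigma> r \<and> (e \<longrightarrow> yields_on True \<sigma> l \<or> yields_on True \<sigma> r))"

lemma ctx_cong: "stack_type \<sigma> = stack_type \<sigma>' \<Longrightarrow> ctx e \<sigma> A \<gamma> A' \<gamma>' \<longleftrightarrow> ctx e \<sigma>' A \<gamma> A' \<gamma>'"
  unfolding ctx_def using yields_on_cong[of \<sigma> \<sigma>'] by simp

lemma ctx_weaken: "ctx e \<sigma> A \<gamma> A' \<gamma>' \<Longrightarrow> (d \<Longrightarrow> e) \<Longrightarrow> ctx d \<sigma> A \<gamma> A' \<gamma>'"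
  unfolding ctx_def by blast

lemma ctx_refl: "ctx False \<sigma> A \<gamma> A \<gamma>"
  unfolding ctx_def yields_def using der.Nil[of P]
  by (intro exI[of _ "[]"]) auto

lemma ctx_trans:
  assumes "ctx e \<sigma> A \<gamma> A' \<gamma>'" "ctx e' \<sigma> A' \<gamma>' A'' \<gamma>''"
  shows "ctx (e \<or> e') \<sigma> A \<gamma> A'' \<gamma>''"
proof -
  from assms(1) obtain l r where 1: "(istep P)\<^sup>*\<^sup>* [Nt A \<gamma>] (l @ [Nt A' \<gamma>'] @ r)"
    "yields_on False \<sigma> l" "yields_on False \<sigma> r" "e \<longrightarrow> yields_on True \<sigma> l \<or> yields_on True \<sigma> r"
    unfolding ctx_def by blast
  from assms(2) obtain l' r' where 2: "(istep P)\<^sup>*\<^sup>* [Nt A' \<gamma>'] (l' @ [Nt A'' \<gamma>''] @ r')"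
    "yields_on False \<sigma> l'" "yields_on False \<sigma> r'" "e' \<longrightarrow> yields_on True \<sigma> l' \<or> yields_on True \<sigma> r'"
    unfolding ctx_def by blast
  have "(istep P)\<^sup>*\<^sup>* [Nt A \<gamma>] ((l @ l') @ [Nt A'' \<gamma>''] @ (r' @ r))"
    using rtranclp_trans[OF 1(1) isteps_append[OF 2(1), of l r]] by simp
  moreover have "yields_on False \<sigma> (l @ l')" "yields_on False \<sigma> (r' @ r)"
    using 1 2 by (auto intro: yields_append)
  moreover have "yields_on True \<sigma> (l @ l') \<or> yields_on True \<sigma> (r' @ r)" if "e \<or> e'"
    using that 1(2-4) 2(2-4) by (auto intro: yields_append)
  ultimately show ?thesis
    unfolding ctx_def by blast
qed

text \<open>The side branches get \<open>\<delta>\<close> pushed, so over \<open>\<sigma>\<close>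
  they see the same full stack as before over \<open>\<delta> @ \<sigma>\<close>.\<close>

lemma ctx_append:
  assumes "ctx e (\<delta> @ \<sigma>) A \<gamma> A' \<gamma>'"
  shows "ctx e \<sigma> A (\<gamma> @ \<delta>) A' (\<gamma>' @ \<delta>)"
proof -
  from assms obtain l r where 1: "(istep P)\<^sup>*\<^sup>* [Nt A \<gamma>] (l @ [Nt A' \<gamma>'] @ r)"
    "yields_on False (\<delta> @ \<sigma>) l" "yields_on False (\<delta> @ \<sigma>) r"
    "e \<longrightarrow> yields_on True (\<delta> @ \<sigma>) l \<or> yields_on True (\<delta> @ \<sigma>) r"
    unfolding ctx_def by blast
  show ?thesis
    unfolding ctx_def
    using isteps_inst[OF 1(1), of \<delta>] 1(2-4)
    by (intro exI[of _ "map (inst_stack \<delta>) l"] exI[of _ "map (inst_stack \<delta>) r"]) simp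
qed

lemma ctx_yields:
  assumes "ctx e \<sigma> A \<gamma> A' \<gamma>'" "yields False [Nt A' (\<gamma>' @ \<sigma>)]"
  shows "yields False [Nt A (\<gamma> @ \<sigma>)]"
proof -
  from assms(1) obtain l r where 1: "(istep P)\<^sup>*\<^sup>* [Nt A \<gamma>] (l @ [Nt A' \<gamma>'] @ r)"
    "yields_on False \<sigma> l" "yields_on False \<sigma> r"
    unfolding ctx_def by blast
  show ?thesis
    by (rule yields_isteps[OF isteps_inst[OF 1(1), of \<sigma>, simplified]])
      (use yields_append[OF 1(2) yields_append[OF assms(2) 1(3)], of False False] in simp)
qed

text \<open>A context on full stacks whose side branches are already rewritten to words; these words
  become the pumped blocks.\<close>

definition wctx :: "'t list \<Rightarrow> 'n \<Rightarrow> 'f list \<Rightarrow> 'n \<Rightarrow> 'f list \<Rightarrow> 't list \<Rightarrow> bool" where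
  "wctx x A \<sigma> A' \<sigma>' y \<longleftrightarrow> (istep P)\<^sup>*\<^sup>* [Nt A \<sigma>] (map Tm x @ [Nt A' \<sigma>'] @ map Tm y)"

lemma wctx_refl: "wctx [] A \<sigma> A \<sigma> []"
  by (simp add: wctx_def)

lemma wctx_trans:
  "wctx x A \<sigma> A' \<sigma>' y \<Longrightarrow> wctx x' A' \<sigma>' A'' \<sigma>'' y' \<Longrightarrow> wctx (x @ x') A \<sigma> A'' \<sigma>'' (y' @ y)"
  unfolding wctx_def
  using isteps_append[of P "[Nt A' \<sigma>']" _ "map Tm x" "map Tm y"] by (fastforce intro: rtranclp_trans)

lemma wctx_der: "wctx x A \<sigma> A' \<sigma>' y \<Longrightarrow> der P [Nt A' \<sigma>'] w \<Longrightarrow> der P [Nt A \<sigma>] (x @ w @ y)"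
  unfolding wctx_def
  by (elim der_isteps) (intro der_append der_map_Tm)

lemma wctx_upto:
  assumes "\<And>n. wctx (X n) A (T n) A (T (Suc n)) (Y n)"
  shows "wctx (concat (map X [0..<N])) A (T 0) A (T N) (concat (map Y (rev [0..<N])))"
proof (induction N)
  case (Suc N)
  from wctx_trans[OF Suc assms[of N]] show ?case by simp
qed (simp add: wctx_refl)

lemma wctx_downto:
  assumes "\<And>n. wctx (X n) A (T (Suc n)) A (T n) (Y n)"
  shows "wctx (concat (map X (rev [0..<N]))) A (T N) A (T 0) (concat (map Y [0..<N]))"
proof (induction N)
  case (Suc N)
  from wctx_trans[OF assms[of N] Suc] show ?case by simp
qed (simp add: wctx_refl)

text \<open>Equal types let the side branches terminate over every \<open>\<rho> n\<close>. The
  words depend on \<open>n\<close>, but the side that holds a letter of \<open>B\<close> does not,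
  as the criteria for rarity require.\<close>

lemma wctx_family:
  assumes "ctx e \<sigma> A \<gamma> A' \<gamma>'" "\<And>n. stack_type (\<rho> n) = stack_type \<sigma>"
  shows "\<exists>X Y. (\<forall>n :: nat. wctx (X n) A (\<gamma> @ \<rho> n) A' (\<gamma>' @ \<rho> n) (Y n)) \<and>
    (e \<longrightarrow> (\<forall>n. set (X n) \<inter> B \<noteq> {}) \<or> (\<forall>n. set (Y n) \<inter> B \<noteq> {}))"
proof -
  from assms(1) obtain l r where 1: "(istep P)\<^sup>*\<^sup>* [Nt A \<gamma>] (l @ [Nt A' \<gamma>'] @ r)"
    and 2: "yields_on False \<sigma> l" "yields_on False \<sigma> r" "e \<longrightarrow> yields_on True \<sigma> l \<or> yields_on True \<sigma> r"
    unfolding ctx_def by blast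
  \<comment> \<open>The marked side is chosen here, before any \<open>n\<close> is
    considered.\<close>
  from 2 obtain b c where "yields_on b \<sigma> l" "yields_on c \<sigma> r" and e: "e \<longrightarrow> b \<or> c"
    by blast
  then have "yields_on b (\<rho> n) l" "yields_on c (\<rho> n) r" for n
    using yields_on_cong[OF assms(2)] by blast+
  then obtain X Y where X: "\<And>n. der P (map (inst_stack (\<rho> n)) l) (X n)" "\<And>n. b \<Longrightarrow> set (X n) \<inter> B \<noteq> {}"
    and Y: "\<And>n. der P (map (inst_stack (\<rho> n)) r) (Y n)" "\<And>n. c \<Longrightarrow> set (Y n) \<inter> B \<noteq> {}"
    unfolding yields_def by metis
  have "wctx (X n) A (\<gamma> @ \<rho> n) A' (\<gamma>' @ \<rho> n) (Y n)" for n
  proof -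
    let ?l = "map (inst_stack (\<rho> n)) l" and ?r = "map (inst_stack (\<rho> n)) r" and ?N = "[Nt A' (\<gamma>' @ \<rho> n)]"
    have "(istep P)\<^sup>*\<^sup>* [Nt A (\<gamma> @ \<rho> n)] (?l @ ?N @ ?r)"
      using isteps_inst[OF 1, of "\<rho> n"] by simp
    also have "(istep P)\<^sup>*\<^sup>* (?l @ ?N @ ?r) (map Tm (X n) @ ?N @ ?r)"
      using isteps_append[OF isteps_der[OF X(1)], of "[]"] by simp
    also have "(istep P)\<^sup>*\<^sup>* (map Tm (X n) @ ?N @ ?r) (map Tm (X n) @ ?N @ map Tm (Y n))"
      using isteps_append[OF isteps_der[OF Y(1)], of "map Tm (X n) @ ?N" n "[]"] by simp
    finally show ?thesis by (simp add: wctx_def)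
  qed
  with X(2) Y(2) e show ?thesis by blast
qed

lemma wctx_of_ctx:
  assumes "ctx e [] A \<gamma> A' \<gamma>'"
  obtains x y where "wctx x A \<gamma> A' \<gamma>' y"
  using wctx_family[OF assms, of "\<lambda>_. []"] that by auto

lemma stack_type_power:
  assumes "stack_type (\<gamma> @ \<sigma>) = stack_type \<sigma>"
  shows "stack_type (concat (replicate n \<gamma>) @ \<sigma>) = stack_type \<sigma>"
proof (induction n)
  case (Suc n)
  from stack_type_append[OF this, of \<gamma>] assms show ?case by simp
qed simp

text \<open>The letters come from the pushing loop: its \<open>n\<close>-th round starts at
  \<open>\<delta> @ \<rho> n\<close>. The levels increase inward, so left blocks appear in
  increasing and right blocks in decreasing order.\<close>

lemma pump_up:
  assumes S: "ctx False [] S s A (\<delta> @ \<sigma>)" and A: "yields False [Nt A (\<delta> @ \<sigma>)]"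
    and up: "ctx True \<sigma> A \<delta> A (\<delta> @ \<gamma>)" and ty: "stack_type (\<gamma> @ \<sigma>) = stack_type \<sigma>"
  shows "\<not> rare B {w. der P [Nt S s] w}"
proof -
  define \<rho> where "\<rho> n = concat (replicate n \<gamma>) @ \<sigma>" for n
  have ty': "stack_type (\<rho> n) = stack_type \<sigma>" for n
    unfolding \<rho>_def by (rule stack_type_power[OF ty])
  obtain x y where xy: "wctx x S s A (\<delta> @ \<rho> 0) y"
    using wctx_of_ctx[OF S] by (auto simp: \<rho>_def)
  obtain X Y where XY: "\<And>n. wctx (X n) A (\<delta> @ \<rho> n) A (\<delta> @ \<rho> (Suc n)) (Y n)"
    "(\<forall>n. set (X n) \<inter> B \<noteq> {}) \<or> (\<forall>n. set (Y n) \<inter> B \<noteq> {})"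
    using wctx_family[OF up, of \<rho>, OF ty'] by (auto simp: \<rho>_def)
  have "yields_on False \<sigma> [Nt A \<delta>]" using A by simp
  then have "yields_on False (\<rho> n) [Nt A \<delta>]" for n
    using yields_on_cong[OF ty'] by blast
  then obtain v where v: "\<And>n. der P [Nt A (\<delta> @ \<rho> n)] (v n)"
    unfolding yields_def by simp metis
  have "(x @ concat (map X [0..<N])) @ v N @ (concat (map Y (rev [0..<N])) @ y) \<in> {w. der P [Nt S s] w}" for N
    using wctx_der[OF wctx_trans[OF xy wctx_upto[of X A "\<lambda>n. \<delta> @ \<rho> n" Y, OF XY(1)]] v] by simp
  then have w: "\<exists>a c. a @ concat (map X [0..<N]) @ c \<in> {w. der P [Nt S s] w}"
    "\<exists>a c. a @ concat (map Y (rev [0..<N])) @ c \<in> {w. der P [Nt S s] w}" for N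
    by (metis append.assoc)+
  from XY(2) w show ?thesis
    using not_rare_upto[of X] not_rare_downto[of Y] by blast
qed

text \<open>The letters come from popping: \<open>N\<close> rounds of \<open>up\<close> build the
  stack, \<open>mid\<close> exposes \<open>\<rho> N\<close>, and \<open>N\<close> rounds of
  \<open>down\<close> remove the copies of \<open>\<gamma>\<close>. Levels now decrease inward,
  which reverses the order of the blocks on both sides.\<close>

lemma pump_down:
  assumes S: "ctx False [] S s A (\<delta> @ \<sigma>)" and up: "ctx False \<sigma> A \<delta> A (\<delta> @ \<gamma>)"
    and mid: "ctx False \<sigma> A \<delta> Z []" and down: "ctx True \<sigma> Z \<gamma> Z []"
    and Z: "yields False [Nt Z \<sigma>]" and ty: "stack_type (\<gamma> @ \<sigma>) = stack_type \<sigma>"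
  shows "\<not> rare B {w. der P [Nt S s] w}"
proof -
  define \<rho> where "\<rho> n = concat (replicate n \<gamma>) @ \<sigma>" for n
  have ty': "stack_type (\<rho> n) = stack_type \<sigma>" for n
    unfolding \<rho>_def by (rule stack_type_power[OF ty])
  obtain x y where xy: "wctx x S s A (\<delta> @ \<rho> 0) y"
    using wctx_of_ctx[OF S] by (auto simp: \<rho>_def)
  obtain X Y where XY: "\<And>n. wctx (X n) A (\<delta> @ \<rho> n) A (\<delta> @ \<rho> (Suc n)) (Y n)"
    using wctx_family[OF up, of \<rho>, OF ty'] by (auto simp: \<rho>_def)
  obtain M M' where M: "\<And>n. wctx (M n) A (\<delta> @ \<rho> n) Z (\<rho> n) (M' n)"
    using wctx_family[OF mid, of \<rho>, OF ty'] by auto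
  obtain U V where UV: "\<And>n. wctx (U n) Z (\<rho> (Suc n)) Z (\<rho> n) (V n)"
    "(\<forall>n. set (U n) \<inter> B \<noteq> {}) \<or> (\<forall>n. set (V n) \<inter> B \<noteq> {})"
    using wctx_family[OF down, of \<rho>, OF ty'] by (auto simp: \<rho>_def)
  obtain v where v: "der P [Nt Z (\<rho> 0)] v"
    using Z unfolding yields_def by (auto simp: \<rho>_def)
  have "\<exists>a b c. a @ concat (map U (rev [0..<N])) @ b @ concat (map V [0..<N]) @ c \<in> {w. der P [Nt S s] w}" for N
    using wctx_der[OF wctx_trans[OF wctx_trans[OF wctx_trans[OF xy
      wctx_upto[of X A "\<lambda>n. \<delta> @ \<rho> n" Y, OF XY]] M] wctx_downto[of U Z \<rho> V N, OF UV(1)]] v]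
    by (simp del: upt_Suc) (metis append.assoc)
  then have w: "\<exists>a c. a @ concat (map U (rev [0..<N])) @ c \<in> {w. der P [Nt S s] w}"
    "\<exists>a c. a @ concat (map V [0..<N]) @ c \<in> {w. der P [Nt S s] w}" for N
    by (metis append.assoc)+
  from UV(2) w show ?thesis
    using not_rare_upto[of V] not_rare_downto[of U] by blast
qed

section \<open>Runs along a path of the derivation tree\<close>

text \<open>\<open>run k m A \<gamma> \<sigma> X\<close> is a path of at most \<open>k\<close> steps down a derivation tree, from \<open>A\<close> with stack
  \<open>\<gamma> @ \<sigma>\<close> until \<open>\<gamma>\<close> has been popped, arriving at \<open>Z\<close> with stack \<open>\<sigma>\<close> if \<open>X = Some Z\<close>; \<open>X = None\<close>
  means that the path was abandoned before. At least \<open>m\<close> of its steps leave aside a subtree that can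
  contribute a letter of \<open>B\<close>.\<close>

inductive run :: "nat \<Rightarrow> nat \<Rightarrow> 'n \<Rightarrow> 'f list \<Rightarrow> 'f list \<Rightarrow> 'n option \<Rightarrow> bool" where
  arrive: "run k 0 A [] \<sigma> (Some A)"
| abandon: "yields False [Nt A (\<gamma> @ \<sigma>)] \<Longrightarrow> run k 0 A \<gamma> \<sigma> None"
| step: "(A, fo, l @ [Nt A' \<delta>] @ r) \<in> P \<Longrightarrow> flags fo @ \<gamma> \<noteq> [] \<Longrightarrow>
    yields_on False (\<gamma> @ \<sigma>) l \<Longrightarrow> yields_on False (\<gamma> @ \<sigma>) r \<Longrightarrow>
    (e \<Longrightarrow> yields_on True (\<gamma> @ \<sigma>) l \<or> yields_on True (\<gamma> @ \<sigma>) r) \<Longrightarrow>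
    run k m A' (\<delta> @ \<gamma>) \<sigma> X \<Longrightarrow> run (Suc k) (m + of_bool e) A (flags fo @ \<gamma>) \<sigma> X"

lemma step_ctx:
  assumes "(A, fo, l @ [Nt A' \<delta>] @ r) \<in> P" "yields_on False (\<gamma> @ \<sigma>) l" "yields_on False (\<gamma> @ \<sigma>) r"
    "e \<Longrightarrow> yields_on True (\<gamma> @ \<sigma>) l \<or> yields_on True (\<gamma> @ \<sigma>) r"
  shows "ctx e \<sigma> A (flags fo @ \<gamma>) A' (\<delta> @ \<gamma>)"
proof (rule ctx_append)
  show "ctx e (\<gamma> @ \<sigma>) A (flags fo) A' \<delta>"
    unfolding ctx_def using istep_prod[OF assms(1), of "[]"] assms(2-)
    by (intro exI[of _ l] exI[of _ r]) (auto simp: id_def)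
qed

lemma run_Suc: "run k m A \<gamma> \<sigma> X \<Longrightarrow> run (Suc k) m A \<gamma> \<sigma> X"
proof (induction rule: run.induct)
  case (step A fo l A' \<delta> r \<gamma> \<sigma> e k m X)
  show ?case
    by (rule run.step) (use step in auto)
qed (auto intro: run.intros)

lemma run_Nil: "run k m A [] \<sigma> X \<Longrightarrow> m = 0"
  by (erule run.cases) auto

text \<open>\<open>\<gamma>'\<close> stays untouched until \<open>\<gamma>\<close> is popped, so the
  run divides at that moment and the marks add up. Both pieces keep \<open>k\<close>, which is only
  an upper bound serving as induction measure.\<close>

lemma run_split:
  assumes "run k m A (\<gamma> @ \<gamma>') \<sigma> X"
  obtains (abandoned) "run k m A \<gamma> (\<gamma>' @ \<sigma>) None" "X = None"
  | (arrived) m1 m2 Z where "run k m1 A \<gamma> (\<gamma>' @ \<sigma>) (Some Z)" "run k m2 Z \<gamma>' \<sigma> X" "m = m1 + m2"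
proof -
  have "(run k m A \<gamma> (\<gamma>' @ \<sigma>) None \<and> X = None) \<or>
      (\<exists>m1 m2 Z. run k m1 A \<gamma> (\<gamma>' @ \<sigma>) (Some Z) \<and> run k m2 Z \<gamma>' \<sigma> X \<and> m = m1 + m2)"
    using assms
  proof (induction k m A "\<gamma> @ \<gamma>'" \<sigma> X arbitrary: \<gamma> rule: run.induct)
    case (arrive k A \<sigma>)
    then show ?case by (auto intro: run.arrive)
  next
    case (abandon A \<sigma> k)
    then show ?case by (auto intro: run.abandon)
  next
    case (step A fo l A' \<delta> r \<tau> \<sigma> e k m X)
    show ?case
    proof (cases "\<gamma> = []")
      case True
      have "run (Suc k) (m + of_bool e) A (flags fo @ \<tau>) \<sigma> X"
        by (rule run.step) (use step.hyps in auto)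
      with True step.hyps(8) have "run (Suc k) (m + of_bool e) A \<gamma>' \<sigma> X" by simp
      moreover have "run (Suc k) 0 A \<gamma> (\<gamma>' @ \<sigma>) (Some A)" using True by (simp add: run.arrive)
      ultimately show ?thesis by force
    next
      case False
      from step.hyps(8)[symmetric] False obtain \<gamma>1 where g: "\<gamma> = flags fo @ \<gamma>1" "\<tau> = \<gamma>1 @ \<gamma>'"
        by (rule flags_append_cases)
      have *: "run (Suc k) (n + of_bool e) A \<gamma> (\<gamma>' @ \<sigma>) Y" if "run k n A' (\<delta> @ \<gamma>1) (\<gamma>' @ \<sigma>) Y" for n Y
        unfolding g(1)
        by (rule run.step[OF step.hyps(1)]) (use that step.hyps(3-5) False g in auto)
      from step.hyps(7)[of "\<delta> @ \<gamma>1"] consider "run k m A' (\<delta> @ \<gamma>1) (\<gamma>' @ \<sigma>) None" "X = None"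
        | m1 m2 Z where "run k m1 A' (\<delta> @ \<gamma>1) (\<gamma>' @ \<sigma>) (Some Z)" "run k m2 Z \<gamma>' \<sigma> X" "m = m1 + m2"
        by (auto simp: g(2))
      then show ?thesis
      proof cases
        case 1
        with * show ?thesis by blast
      next
        case 2
        from *[OF 2(1)] run_Suc[OF 2(2)] 2(3) show ?thesis by fastforce
      qed
    qed
  qed
  then show ?thesis using that by blast
qed

lemma run_ctx: "run k m A \<gamma> \<sigma> X \<Longrightarrow> X = Some Z \<Longrightarrow> ctx (m > 0) \<sigma> A \<gamma> Z []"
proof (induction rule: run.induct)
  case (step A fo l A' \<delta> r \<gamma> \<sigma> e k m X)
  from ctx_trans[OF step_ctx[OF step.hyps(1,3,4,5)] step.IH[OF step.prems]]
  show ?case by (rule ctx_weaken) (auto split: if_splits)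
qed (auto intro: ctx_refl)

lemma run_yields:
  "run k m A \<gamma> \<sigma> X \<Longrightarrow> (\<And>Z. X = Some Z \<Longrightarrow> yields False [Nt Z \<sigma>]) \<Longrightarrow> yields False [Nt A (\<gamma> @ \<sigma>)]"
proof (induction rule: run.induct)
  case (step A fo l A' \<delta> r \<gamma> \<sigma> e k m X)
  from ctx_yields[OF step_ctx[OF step.hyps(1,3,4,5)]] step.IH[OF step.prems]
  show ?case by auto
qed auto

section \<open>Nesting of runs\<close>

text \<open>The two options are the targets of the inner and of the outer run; after the inner one,
  \<open>\<gamma>\<close> remains to be popped. An abandoned inner run cannot lie in an arriving
  outer one. Hence nesting never returns from \<open>Some\<close> to \<open>None\<close>, no cycle
  uses the third equation, and it can be unconditional.\<close>

fun closes :: "bool \<Rightarrow> bool \<Rightarrow> 'f list \<Rightarrow> 'f list \<Rightarrow> 'n option \<Rightarrow> 'n option \<Rightarrow> bool" where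
  "closes e e1 \<sigma> \<gamma> None None \<longleftrightarrow> (e \<longrightarrow> e1)"
| "closes e e1 \<sigma> \<gamma> None (Some Z) \<longleftrightarrow> False"
| "closes e e1 \<sigma> \<gamma> (Some Z') None \<longleftrightarrow> True"
| "closes e e1 \<sigma> \<gamma> (Some Z') (Some Z) \<longleftrightarrow> (\<exists>e2. ctx e2 \<sigma> Z' \<gamma> Z [] \<and> (e \<longrightarrow> e1 \<or> e2))"

text \<open>A label \<open>(A, f, stack_type \<sigma>, X)\<close> abstracts a run from \<open>A\<close> with stack \<open>f # \<sigma>\<close> to \<open>X\<close> with stack
  \<open>\<sigma>\<close>. A run with the second label can be nested in one with the first; if \<open>e\<close> holds, then with a
  letter of \<open>B\<close> coming from the outer part.\<close>

fun nest :: "bool \<Rightarrow> 'n \<times> 'f \<times> (bool \<times> 'n) set \<times> 'n option \<Rightarrow> 'n \<times> 'f \<times> (bool \<times> 'n) set \<times> 'n option \<Rightarrow> bool" where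
  "nest e (A, f, T, X) (A', f', T', X') \<longleftrightarrow> (\<exists>\<sigma> \<gamma> e1. T = stack_type \<sigma> \<and> T' = stack_type (\<gamma> @ \<sigma>) \<and>
     ctx e1 \<sigma> A [f] A' (f' # \<gamma>) \<and> closes e e1 \<sigma> \<gamma> X' X)"

lemma closes_cong:
  assumes "stack_type \<sigma> = stack_type \<sigma>'"
  shows "closes e e1 \<sigma> \<gamma> X' X \<longleftrightarrow> closes e e1 \<sigma>' \<gamma> X' X"
  using ctx_cong[OF assms] by (cases X'; cases X) auto

lemma closes_trans:
  assumes "closes e' e1' (\<gamma> @ \<sigma>) \<gamma>' X'' X'" "closes e e1 \<sigma> \<gamma> X' X"
  shows "closes (e \<or> e') (e1 \<or> e1') \<sigma> (\<gamma>' @ \<gamma>) X'' X"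
proof (cases X'')
  case None
  with assms show ?thesis by (cases X'; cases X) auto
next
  case (Some Z'')
  show ?thesis
  proof (cases X)
    case X: (Some Z)
    with assms Some obtain Z' where X': "X' = Some Z'" by (cases X') auto
    from assms X X' Some obtain e2 e2' where "ctx e2' (\<gamma> @ \<sigma>) Z'' \<gamma>' Z' []" "ctx e2 \<sigma> Z' \<gamma> Z []"
      and e: "e' \<longrightarrow> e1' \<or> e2'" "e \<longrightarrow> e1 \<or> e2" by auto
    from ctx_trans[OF ctx_append[OF this(1), simplified] this(2)] e show ?thesis
      unfolding X Some closes.simps by blast
  qed (simp add: Some)
qed

text \<open>The second nesting has its own witness \<open>\<sigma>'\<close>, but of the same type as
  \<open>\<gamma> @ \<sigma>\<close>, so its contexts can be moved onto that stack and composed with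
  the first.\<close>

lemma nest_trans:
  assumes "nest e t t'" "nest e' t' t''"
  shows "nest (e \<or> e') t t''"
proof -
  obtain A f T X where t: "t = (A, f, T, X)" by (cases t)
  obtain A' f' T' X' where t': "t' = (A', f', T', X')" by (cases t')
  obtain A'' f'' T'' X'' where t'': "t'' = (A'', f'', T'', X'')" by (cases t'')
  from assms(1)[unfolded t t'] obtain \<sigma> \<gamma> e1 where 1: "T = stack_type \<sigma>" "T' = stack_type (\<gamma> @ \<sigma>)"
    "ctx e1 \<sigma> A [f] A' (f' # \<gamma>)" "closes e e1 \<sigma> \<gamma> X' X" by auto
  from assms(2)[unfolded t' t''] obtain \<sigma>' \<gamma>' e1' where 2: "T' = stack_type \<sigma>'" "T'' = stack_type (\<gamma>' @ \<sigma>')"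
    "ctx e1' \<sigma>' A' [f'] A'' (f'' # \<gamma>')" "closes e' e1' \<sigma>' \<gamma>' X'' X'" by auto
  have ty: "stack_type \<sigma>' = stack_type (\<gamma> @ \<sigma>)" using 1(2) 2(1) by simp
  have "ctx e1' \<sigma> A' (f' # \<gamma>) A'' (f'' # \<gamma>' @ \<gamma>)"
    using ctx_append[of e1' \<gamma> \<sigma> A' "[f']" A'' "f'' # \<gamma>'"] 2(3) ctx_cong[OF ty] by simp
  from ctx_trans[OF 1(3) this] have "ctx (e1 \<or> e1') \<sigma> A [f] A'' (f'' # \<gamma>' @ \<gamma>)" .
  moreover have "closes (e \<or> e') (e1 \<or> e1') \<sigma> (\<gamma>' @ \<gamma>) X'' X"
    using closes_trans[OF _ 1(4)] 2(4) closes_cong[OF ty] by blast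
  moreover have "T'' = stack_type ((\<gamma>' @ \<gamma>) @ \<sigma>)"
    using 2(2) stack_type_append[OF ty, of \<gamma>'] by simp
  ultimately show ?thesis
    unfolding t t'' nest.simps using 1(1) by blast
qed

text \<open>If the outer letter arises on the way down to the inner run, \<open>pump_up\<close>
  applies. Otherwise \<open>closes\<close> forces the run to arrive and places the letter in the
  popping of \<open>\<gamma>\<close>, which \<open>pump_down\<close> iterates.\<close>

lemma self_nest_not_rare:
  assumes S: "ctx False [] S s A (f # \<sigma>)" and run: "run k m A [f] \<sigma> X"
    and X: "\<And>Z. X = Some Z \<Longrightarrow> yields False [Nt Z \<sigma>]"
    and nest: "nest True (A, f, stack_type \<sigma>, X) (A, f, stack_type \<sigma>, X)"
  shows "\<not> rare B {w. der P [Nt S s] w}"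
proof -
  from nest obtain \<sigma>' \<gamma> e1 where ty: "stack_type \<sigma> = stack_type \<sigma>'" "stack_type \<sigma> = stack_type (\<gamma> @ \<sigma>')"
    and up: "ctx e1 \<sigma>' A [f] A (f # \<gamma>)" and cl: "closes True e1 \<sigma>' \<gamma> X X" by auto
  \<comment> \<open>The witness \<open>\<sigma>'\<close> is exchanged for the actual stack
    \<open>\<sigma>\<close>, the one reached from \<open>S\<close>.\<close>
  have ty': "stack_type (\<gamma> @ \<sigma>) = stack_type \<sigma>"
    using stack_type_append[OF ty(1), of \<gamma>] ty(2) by simp
  have up': "ctx e1 \<sigma> A [f] A ([f] @ \<gamma>)" and cl': "closes True e1 \<sigma> \<gamma> X X"
    using ctx_cong[OF ty(1)] closes_cong[OF ty(1)] up cl by auto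
  have S': "ctx False [] S s A ([f] @ \<sigma>)" using S by simp
  show ?thesis
  proof (cases e1)
    case True
    with up' have "ctx True \<sigma> A [f] A ([f] @ \<gamma>)" by simp
    from pump_up[OF S' run_yields[OF run X] this ty'] show ?thesis by simp
  next
    case False
    with cl' obtain Z where Z: "X = Some Z" "ctx True \<sigma> Z \<gamma> Z []" by (cases X) auto
    have "ctx False \<sigma> A [f] Z []"
      using run_ctx[OF run Z(1)] by (rule ctx_weaken) simp
    from pump_down[OF S' ctx_weaken[OF up'] this Z(2) X[OF Z(1)] ty'] show ?thesis by simp
  qed
qed

end

section \<open>Counting letters and the recursive bound\<close>

lemma der_concat: "list_all2 (\<lambda>s v. der P [s] v) u vs \<Longrightarrow> der P u (concat vs)"
proof (induction rule: list_all2_induct)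
  case Nil
  then show ?case by (simp add: der.Nil)
next
  case (Cons s u v vs)
  from der_append[OF Cons(1,3)] show ?case by simp
qed

lemma count_in_concat_le:
  "(\<And>v. v \<in> set vs \<Longrightarrow> count_in B v \<le> c) \<Longrightarrow> count_in B (concat vs) \<le> length vs * c"
proof (induction vs)
  case (Cons v vs)
  then show ?case by (simp add: add_mono)
qed (simp add: count_in_def)

lemma obtain_split_max:
  fixes f :: "'a \<Rightarrow> nat"
  assumes "vs \<noteq> []"
  obtains vs1 v vs2 where "vs = vs1 @ v # vs2" "\<And>x. x \<in> set vs \<Longrightarrow> f x \<le> f v"
proof -
  have "Max (f ` set vs) \<in> f ` set vs" using assms by (intro Max_in) auto
  then obtain v where "v \<in> set vs" "f v = Max (f ` set vs)" by auto
  moreover from this(2) have "f x \<le> f v" if "x \<in> set vs" for x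
    using that by simp
  ultimately show ?thesis using that by (metis split_list)
qed

text \<open>One production step: 1 for the step itself, then at most \<open>d\<close> flags, each
  popped by a run of smaller rank.\<close>

primrec run_bound :: "nat \<Rightarrow> nat \<Rightarrow> nat" where
  "run_bound d 0 = 1"
| "run_bound d (Suc r) = 1 + d * run_bound d r"

lemma run_bound_mono:
  assumes "d \<ge> 1" "r \<le> r'"
  shows "run_bound d r \<le> run_bound d r'"
proof -
  have "run_bound d n \<le> run_bound d (Suc n)" for n
  proof -
    have "1 * run_bound d n \<le> d * run_bound d n" using assms(1) by (intro mult_right_mono) auto
    then show ?thesis unfolding run_bound.simps by linarith
  qed
  then show ?thesis using assms(2) by (rule lift_Suc_mono_le)
qed

section \<open>Bounding the number of letters for a finite grammar\<close>

text \<open>\<open>bot\<close> is a bottom marker: it keeps every stack of a derivation nonempty,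
  and the whole path becomes a run on the single flag \<open>bot\<close>. The strict bound on pushed
  flags leaves room for one inherited flag.\<close>

locale finite_grammar = marked_grammar P B
  for P :: "('n, 'f, 't) iprod set" and B :: "'t set" +
  fixes S :: 'n and bot :: 'f and NT :: "'n set" and FL :: "'f set" and d :: nat
  assumes finite_NT: "finite NT" and finite_FL: "finite FL" and S: "S \<in> NT" and bot: "bot \<in> FL"
    and lhs: "(A, fo, rhs) \<in> P \<Longrightarrow> A \<in> NT" and length_rhs: "(A, fo, rhs) \<in> P \<Longrightarrow> length rhs \<le> d"
    and rhs: "(A, fo, rhs) \<in> P \<Longrightarrow> Nt A' \<delta> \<in> set rhs \<Longrightarrow> A' \<in> NT \<and> set \<delta> \<subseteq> FL \<and> length \<delta> < d"
    and bot_not_popped: "(A, Some bot, rhs) \<notin> P" and d: "d \<ge> 1"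
begin

definition bottomed :: "'f list \<Rightarrow> bool" where
  "bottomed \<sigma> \<longleftrightarrow> \<sigma> \<noteq> [] \<and> last \<sigma> = bot"

lemma bottomed_pop: "(A, fo, rhs) \<in> P \<Longrightarrow> bottomed (flags fo @ \<sigma>) \<Longrightarrow> bottomed (\<delta> @ \<sigma>)"
  using bot_not_popped by (cases fo) (auto simp: bottomed_def split: if_splits)

text \<open>Following at each step the child with most letters of \<open>B\<close> loses at most a factor \<open>d\<close>, and
  nothing if its siblings have no letter of \<open>B\<close>.\<close>

lemma ex_heavy_run:
  assumes "der P [Nt A \<sigma>] w" "bottomed \<sigma>"
  shows "\<exists>k m. run k m A \<sigma> [] None \<and> count_in B w \<le> d ^ Suc m"
proof -
  \<comment> \<open>Induction on \<open>der\<close> concerns sentential forms; \<open>Q\<close>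
    states the claim per symbol, so that it is available for each child.\<close>
  define Q where "Q s v \<longleftrightarrow> (\<forall>A \<sigma>. s = Nt A \<sigma> \<longrightarrow> bottomed \<sigma> \<longrightarrow>
    (\<exists>k m. run k m A \<sigma> [] None \<and> count_in B v \<le> d ^ Suc m))" for s :: "('n, 'f, 't) isym" and v
  have "\<exists>ws. w = concat ws \<and> list_all2 (\<lambda>s v. der P [s] v \<and> Q s v) u ws" if "der P u w" for u w
    using that
  proof (induction rule: der.induct)
    case Nil
    then show ?case by (intro exI[of _ "[]"]) simp
  next
    case (Tm u w a)
    then obtain ws where "w = concat ws" "list_all2 (\<lambda>s v. der P [s] v \<and> Q s v) u ws" by blast
    then show ?case
      using der.Tm[OF der.Nil, of P a] by (intro exI[of _ "[a] # ws"]) (simp add: Q_def)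
  next
    case (Nt A fo rhs \<sigma> v u w)
    then obtain vs ws where ws: "w = concat ws" "list_all2 (\<lambda>s v. der P [s] v \<and> Q s v) u ws"
      and v: "v = concat vs" and vs: "list_all2 (\<lambda>s v. der P [s] v \<and> Q s v) (map (inst_stack \<sigma>) rhs) vs"
      by blast
    have der: "der P [Nt A (flags fo @ \<sigma>)] v"
      using der.Nt[OF Nt.hyps(1,2) der.Nil] by simp
    have "\<exists>k m. run k m A (flags fo @ \<sigma>) [] None \<and> count_in B v \<le> d ^ Suc m"
      if bt: "bottomed (flags fo @ \<sigma>)"
    proof -
      \<comment> \<open>With at most \<open>d\<close> letters the path may stop here: no marks give
        the bound \<open>d ^ Suc 0\<close>.\<close>
      have halt: ?thesis if "count_in B v \<le> d"
      proof -
        have "run 0 0 A (flags fo @ \<sigma>) [] None"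
          by (rule run.abandon) (use der in \<open>auto simp: yields_def\<close>)
        with that show ?thesis by (intro exI[of _ 0]) simp
      qed
      show ?thesis
      proof (cases "vs = []")
        case True
        then show ?thesis using halt v by (simp add: count_in_def)
      next
        case False
        then obtain vs1 x vs2 where split: "vs = vs1 @ x # vs2"
          and max: "\<And>y. y \<in> set vs \<Longrightarrow> count_in B y \<le> count_in B x"
          using obtain_split_max[of vs "count_in B"] by blast
        have len: "length vs \<le> d"
          using list_all2_lengthD[OF vs] length_rhs[OF Nt.hyps(1)] by simp
        have le: "count_in B v \<le> d * count_in B x"
          using count_in_concat_le[OF max] len unfolding v by (meson le_trans mult_le_mono1)
        from vs obtain us1 us2 where "map (inst_stack \<sigma>) rhs = us1 @ us2"
          and us: "list_all2 (\<lambda>s v. der P [s] v \<and> Q s v) us1 vs1" "list_all2 (\<lambda>s v. der P [s] v \<and> Q s v) us2 (x # vs2)"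
          unfolding split list_all2_append2 by blast
        then obtain l l' where l': "rhs = l @ l'" "us1 = map (inst_stack \<sigma>) l" "us2 = map (inst_stack \<sigma>) l'"
          unfolding map_eq_append_conv by blast
        with us(2) obtain s r where "l' = s # r" by (cases l') auto
        with us l' have rhs_eq: "rhs = l @ [s] @ r"
          and l: "list_all2 (\<lambda>s v. der P [s] v \<and> Q s v) (map (inst_stack \<sigma>) l) vs1"
          and x: "der P [inst_stack \<sigma> s] x" "Q (inst_stack \<sigma> s) x"
          and r: "list_all2 (\<lambda>s v. der P [s] v \<and> Q s v) (map (inst_stack \<sigma>) r) vs2"
          by auto
        show ?thesis
        proof (cases s)
          \<comment> \<open>If the heaviest child is a terminal, each of the at most
            \<open>d\<close> children has at most one letter.\<close>
          case (Tm a)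
          with x(1) have "x = [a]" by (auto elim: der.cases)
          then have "count_in B x \<le> 1" by (simp add: count_in_def)
          then have "d * count_in B x \<le> d" by simp
          with le have "count_in B v \<le> d" by (rule le_trans)
          then show ?thesis by (rule halt)
        next
          case s: (Nt A' \<delta>)
          have "bottomed (\<delta> @ \<sigma>)" using bottomed_pop[OF Nt.hyps(1) bt] .
          with x(2) s obtain k m where run: "run k m A' (\<delta> @ \<sigma>) [] None" and m: "count_in B x \<le> d ^ Suc m"
            by (auto simp: Q_def)
          have dl: "der P (map (inst_stack \<sigma>) l) (concat vs1)" and dr: "der P (map (inst_stack \<sigma>) r) (concat vs2)"
            using l r by (auto intro!: der_concat elim: list_all2_mono)
          define e where "e \<longleftrightarrow> set (concat vs1) \<inter> B \<noteq> {} \<or> set (concat vs2) \<inter> B \<noteq> {}"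
          have "run (Suc k) (m + of_bool e) A (flags fo @ \<sigma>) [] None"
          proof (rule run.step)
            show "(A, fo, l @ [Nt A' \<delta>] @ r) \<in> P" using Nt.hyps(1) rhs_eq s by simp
            show "flags fo @ \<sigma> \<noteq> []" using bt by (auto simp: bottomed_def)
            show "yields_on False (\<sigma> @ []) l" "yields_on False (\<sigma> @ []) r"
              using dl dr by (auto simp: yields_def)
            show "yields_on True (\<sigma> @ []) l \<or> yields_on True (\<sigma> @ []) r" if e
              using dl dr that unfolding yields_def e_def append_Nil2 by blast
          qed (rule run)
          moreover have "count_in B v \<le> d ^ Suc (m + of_bool e)"
          proof (cases e)
            case True
            from le m have "count_in B v \<le> d * d ^ Suc m" by (meson le_trans mult_le_mono2)
            with True show ?thesis by simp
          next
            case False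
            then have "count_in B (concat vs1) = 0" "count_in B (concat vs2) = 0"
              using count_in_pos_iff[of B] unfolding e_def by blast+
            then have "count_in B v = count_in B x" by (simp add: v split)
            with m False show ?thesis by simp
          qed
          ultimately show ?thesis by blast
        qed
      qed
    qed
    then have "Q (Nt A (flags fo @ \<sigma>)) v" by (auto simp: Q_def)
    with ws der show ?case by (intro exI[of _ "v # ws"]) simp
  qed
  from this[OF assms(1)] obtain v where "w = v" "Q (Nt A \<sigma>) v"
    by (auto simp: list_all2_Cons1)
  with assms(2) show ?thesis by (auto simp: Q_def)
qed

definition labels :: "('n \<times> 'f \<times> (bool \<times> 'n) set \<times> 'n option) set" where
  "labels = NT \<times> FL \<times> Pow (UNIV \<times> NT) \<times> insert None (Some ` NT)"

text \<open>\<open>Suc\<close> makes the rank positive, so that a predecessor \<open>r\<close>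
  always exists in \<open>run_le\<close>.\<close>

definition rank :: "'n \<times> 'f \<times> (bool \<times> 'n) set \<times> 'n option \<Rightarrow> nat" where
  "rank t = Suc (card {t' \<in> labels. nest True t t'})"

lemma finite_labels: "finite labels"
  unfolding labels_def using finite_NT finite_FL by auto

lemma rank_mono:
  assumes "nest e t t'"
  shows "rank t' \<le> rank t"
proof -
  have "{t'' \<in> labels. nest True t' t''} \<subseteq> {t'' \<in> labels. nest True t t''}"
    using nest_trans[OF assms, of True] by auto
  then show ?thesis
    unfolding rank_def using finite_labels by (simp add: card_mono)
qed

text \<open>By transitivity all labels counted for \<open>t'\<close> are counted for
  \<open>t\<close>, and \<open>t'\<close> itself is counted only for \<open>t\<close>.\<close>

lemma rank_strict_mono:
  assumes "nest True t t'" "t' \<in> labels" "\<not> nest True t' t'"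
  shows "rank t' < rank t"
proof -
  have "{t'' \<in> labels. nest True t' t''} \<subset> {t'' \<in> labels. nest True t t''}"
    using nest_trans[OF assms(1), of True] assms by auto
  then show ?thesis
    unfolding rank_def using finite_labels by (simp add: psubset_card_mono)
qed

lemma stack_type_subset: "stack_type \<sigma> \<subseteq> UNIV \<times> NT"
proof -
  have "A \<in> NT" if "der P [Nt A \<sigma>] w" for A w
    using that by (cases rule: der.cases) (auto intro: lhs)
  then show ?thesis unfolding stack_type_def yields_def by auto
qed

lemma run_target: "run k m A \<gamma> \<sigma> X \<Longrightarrow> A \<in> NT \<Longrightarrow> X \<in> insert None (Some ` NT)"
proof (induction rule: run.induct)
  case (step A fo l A' \<delta> r \<gamma> \<sigma> e k m X)
  from rhs[OF step.hyps(1), of A' \<delta>] step.IH show ?case by simp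
qed auto

lemma label_in_labels:
  "run k m A [f] \<sigma> X \<Longrightarrow> A \<in> NT \<Longrightarrow> f \<in> FL \<Longrightarrow> (A, f, stack_type \<sigma>, X) \<in> labels"
  unfolding labels_def using stack_type_subset run_target by auto

text \<open>Strong induction on \<open>k\<close> for all labels at once: after the first step the
  flags are popped by shorter runs. By rarity and \<open>self_nest_not_rare\<close> no label of such
  a run nests in itself with an outer letter, so the rank drops whenever an outer letter
  exists.\<close>

lemma run_le:
  assumes rare: "rare B {w. der P [Nt S [bot]] w}"
    and "run k m A [f] \<sigma> X" "A \<in> NT" "f \<in> FL" "ctx False [] S [bot] A (f # \<sigma>)"
    "\<And>Z. X = Some Z \<Longrightarrow> yields False [Nt Z \<sigma>]"
  shows "m \<le> run_bound d (rank (A, f, stack_type \<sigma>, X))"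
  using assms(2-)
proof (induction k arbitrary: m A f \<sigma> X rule: less_induct)
  case (less k)
  define t where "t = (A, f, stack_type \<sigma>, X)"
  obtain r where r: "rank t = Suc r" by (simp add: rank_def)
  define F where "F = run_bound d"
  have F: "F i \<le> F j" if "i \<le> j" for i j
    unfolding F_def by (rule run_bound_mono[OF d that])
  \<comment> \<open>The flags of \<open>\<gamma>\<close> are popped by successive nested runs. If two of them contribute, or one of them
    and the step before, then every contributing one has smaller rank.\<close>
  have pops: "(e \<longrightarrow> m' \<le> length \<gamma> * F r) \<and> m' \<le> max (F (Suc r)) (length \<gamma> * F r)"
    if "run k' m' A' \<gamma> \<sigma> X" "ctx e \<sigma> A [f] A' \<gamma>" "A' \<in> NT" "set \<gamma> \<subseteq> FL" "k' < k" for k' m' A' \<gamma> e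
    using that
  proof (induction \<gamma> arbitrary: m' A' e)
    case Nil
    from run_Nil[OF Nil.prems(1)] show ?case by simp
  next
    case (Cons g \<gamma>)
    have S: "ctx False [] S [bot] A' (g # \<gamma> @ \<sigma>)"
      using ctx_trans[OF less.prems(4) ctx_append[of e \<sigma> "[]" A "[f]" A' "g # \<gamma>", simplified]] Cons.prems(2)
      by (auto intro: ctx_weaken)
    \<comment> \<open>A run on \<open>g\<close> obeys the bound of its own rank; with a letter of
      \<open>B\<close> outside it, that rank is at most \<open>r\<close>.\<close>
    have sub: "n \<le> F (rank (A', g, stack_type (\<gamma> @ \<sigma>), Y))"
        "nest True t (A', g, stack_type (\<gamma> @ \<sigma>), Y) \<Longrightarrow> n \<le> F r"
      if run: "run k' n A' [g] (\<gamma> @ \<sigma>) Y" and Y: "\<And>Z. Y = Some Z \<Longrightarrow> yields False [Nt Z (\<gamma> @ \<sigma>)]" for n Y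
    proof -
      show 1: "n \<le> F (rank (A', g, stack_type (\<gamma> @ \<sigma>), Y))"
        unfolding F_def using less.IH[OF Cons.prems(5) run _ _ S Y] Cons.prems(3,4) by simp
      assume n: "nest True t (A', g, stack_type (\<gamma> @ \<sigma>), Y)"
      have "\<not> nest True (A', g, stack_type (\<gamma> @ \<sigma>), Y) (A', g, stack_type (\<gamma> @ \<sigma>), Y)"
        using self_nest_not_rare[OF S run Y] rare by blast
      with n have "rank (A', g, stack_type (\<gamma> @ \<sigma>), Y) < rank t"
        using label_in_labels[OF run] Cons.prems(3,4) by (intro rank_strict_mono) auto
      then have "rank (A', g, stack_type (\<gamma> @ \<sigma>), Y) \<le> r" using r by simp
      from F[OF this] 1 show "n \<le> F r" by simp
    qed
    have nestI: "nest c t (A', g, stack_type (\<gamma> @ \<sigma>), Y)" if "closes c e \<sigma> \<gamma> Y X" for c Y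
      using that Cons.prems(2) unfolding t_def nest.simps by blast
    have weak: "n \<le> F (Suc r)" if "n \<le> F (rank (A', g, stack_type (\<gamma> @ \<sigma>), Y))" "closes c e \<sigma> \<gamma> Y X" for n c Y
      using that(1) F[OF rank_mono[OF nestI[OF that(2)]]] r by simp
    from Cons.prems(1) have "run k' m' A' ([g] @ \<gamma>) \<sigma> X" by simp
    then show ?case
    proof (cases rule: run_split)
      case abandoned
      \<comment> \<open>The path ends inside the run on \<open>g\<close>, so an outer letter can
        only come from before it.\<close>
      have cl: "closes e e \<sigma> \<gamma> None X" using abandoned(2) by simp
      have "m' \<le> F (Suc r)" by (rule weak[OF sub(1)[OF abandoned(1)] cl]) simp
      moreover have "m' \<le> F r" if e
        using sub(2)[OF abandoned(1)] nestI[OF cl] that by simp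
      ultimately show ?thesis by auto
    next
      case (arrived m1 m2 Z)
      have Z: "yields False [Nt Z (\<gamma> @ \<sigma>)]"
        using run_yields[OF arrived(2) less.prems(5)] .
      \<comment> \<open>Outer letters come from before the run on \<open>g\<close>
        (\<open>e\<close>) or from popping \<open>\<gamma>\<close> after it
        (\<open>m2 > 0\<close>).\<close>
      have cl: "closes (e \<or> m2 > 0) e \<sigma> \<gamma> (Some Z) X"
        using run_ctx[OF arrived(2)] by (cases X) auto
      have m1: "m1 \<le> F (Suc r)"
        by (rule weak[OF sub(1)[OF arrived(1)] cl]) (use Z in simp)
      have m1': "m1 \<le> F r" if "e \<or> m2 > 0"
        using sub(2)[OF arrived(1)] nestI[OF cl] that Z by simp
      \<comment> \<open>For the remaining flags the run on \<open>g\<close> is part of what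
        precedes, so its marks count as outer letters.\<close>
      have "ctx (m1 > 0) \<sigma> A' (g # \<gamma>) Z \<gamma>"
        using ctx_append[OF run_ctx[OF arrived(1)]] by simp
      from ctx_trans[OF Cons.prems(2) this] have "ctx (e \<or> m1 > 0) \<sigma> A [f] Z \<gamma>" .
      moreover have "Z \<in> NT" using run_target[OF arrived(1)] Cons.prems(3) by auto
      ultimately have "(e \<or> m1 > 0 \<longrightarrow> m2 \<le> length \<gamma> * F r) \<and> m2 \<le> max (F (Suc r)) (length \<gamma> * F r)"
        using Cons.IH[OF arrived(2)] Cons.prems(4,5) by simp
      with m1 m1' show ?thesis
        unfolding arrived(3) by (cases "m1 = 0"; cases "m2 = 0"; cases e) auto
    qed
  qed
  from less.prems(1) have "m \<le> F (Suc r)"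
  proof cases
    case (step fo l A' \<delta> r' \<gamma> e k' m')
    have cx: "ctx e \<sigma> A [f] A' (\<delta> @ \<gamma>)"
      using step_ctx[OF step(4,6,7,8)] step(3) by simp
    have \<delta>: "A' \<in> NT" "set \<delta> \<subseteq> FL" "length \<delta> < d"
      using rhs[OF step(4), of A' \<delta>] by auto
    \<comment> \<open>If \<open>fo = None\<close>, the flag \<open>f\<close> is inherited and
      \<open>\<gamma> = [f]\<close>; with fewer than \<open>d\<close> pushed flags this makes at
      most \<open>d\<close>.\<close>
    have "set \<gamma> \<subseteq> {f}" "length \<gamma> \<le> 1" using step(3) by (cases fo; auto)+
    with \<delta> less.prems(3) have "set (\<delta> @ \<gamma>) \<subseteq> FL" "length (\<delta> @ \<gamma>) \<le> d" by auto
    with pops[OF step(9) cx \<delta>(1)] step(1)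
    have "(e \<longrightarrow> m' \<le> length (\<delta> @ \<gamma>) * F r) \<and> m' \<le> max (F (Suc r)) (length (\<delta> @ \<gamma>) * F r)" by simp
    moreover have "length (\<delta> @ \<gamma>) * F r \<le> d * F r"
      using \<open>length (\<delta> @ \<gamma>) \<le> d\<close> by (rule mult_le_mono1)
    \<comment> \<open>A marked first step adds 1 but puts every flag under \<open>F r\<close>;
      without a mark the maximum suffices.\<close>
    moreover have "F (Suc r) = 1 + d * F r" by (simp add: F_def)
    ultimately show ?thesis unfolding step(2) by (cases e; elim conjE; simp only: of_bool_eq simp_thms; linarith)
  qed auto
  then show ?case using r unfolding t_def F_def by simp
qed

text \<open>Many letters force many marks by \<open>ex_heavy_run\<close>, and \<open>run_le\<close>
  bounds the marks in terms of the start label alone, independently of the word.\<close>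

lemma rare_imp_bounded:
  assumes "rare B {w. der P [Nt S [bot]] w}"
  shows "\<exists>c. \<forall>w. der P [Nt S [bot]] w \<longrightarrow> count_in B w \<le> c"
proof (intro exI allI impI)
  fix w assume "der P [Nt S [bot]] w"
  then obtain k m where run: "run k m S [bot] [] None" and w: "count_in B w \<le> d ^ Suc m"
    using ex_heavy_run[of S "[bot]" w] by (auto simp: bottomed_def)
  have "m \<le> run_bound d (rank (S, bot, stack_type [], None))"
    by (rule run_le[OF assms run S bot ctx_refl]) simp
  then have "d ^ Suc m \<le> d ^ Suc (run_bound d (rank (S, bot, stack_type [], None)))"
    using d by (intro power_increasing) auto
  with w show "count_in B w \<le> d ^ Suc (run_bound d (rank (S, bot, stack_type [], None)))"
    by (rule le_trans)
qed

end

section \<open>From indexed languages to finite grammars with a bottom marker\<close>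

text \<open>Finiteness of \<open>P\<close> bounds everything that occurs in it; flags being natural
  numbers, some flag is popped by no production and can serve as \<open>bot\<close>.\<close>

lemma ex_finite_grammar:
  fixes P :: "(nat, nat, 't) iprod set"
  assumes "finite P"
  shows "\<exists>bot NT FL d. finite_grammar P S bot NT FL d"
proof -
  define R where "R = \<Union> ((\<lambda>(A, fo, rhs). set rhs) ` P)"
  have finR: "finite R" unfolding R_def using assms by auto
  define NT where "NT = insert S (fst ` P \<union> (\<lambda>s. case s of Nt A \<delta> \<Rightarrow> A | Tm _ \<Rightarrow> S) ` R)"
  define FR where "FR = \<Union> ((\<lambda>s. case s of Nt A \<delta> \<Rightarrow> set \<delta> | Tm _ \<Rightarrow> {}) ` R)"
  define DL where "DL = (\<lambda>(A, fo, rhs). length rhs) ` P \<union> (\<lambda>s. case s of Nt A \<delta> \<Rightarrow> length \<delta> | Tm _ \<Rightarrow> 0) ` R"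
  have "finite ((\<lambda>(A, fo, rhs). fo) ` P)" using assms by simp
  then have "finite (Some -` ((\<lambda>(A, fo, rhs). fo) ` P))" by (rule finite_vimageI) simp
  then obtain bot where "bot \<notin> Some -` ((\<lambda>(A, fo, rhs). fo) ` P)"
    using ex_new_if_finite[OF infinite_UNIV_nat] by blast
  then have bot: "(A, Some bot, rhs) \<notin> P" for A rhs by force
  have "finite DL" unfolding DL_def using assms finR by simp
  then obtain d where d: "\<And>n. n \<in> DL \<Longrightarrow> n < d"
    by (metis finite_nat_set_iff_bounded)
  \<comment> \<open>\<open>Suc d\<close> is positive even if \<open>DL\<close> is empty.\<close>
  have "finite_grammar P S bot NT (insert bot FR) (Suc d)"
  proof
    show "finite NT" unfolding NT_def using assms finR by simp
    show "finite (insert bot FR)" unfolding FR_def using finR by (auto split: isym.splits)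
    show "S \<in> NT" by (simp add: NT_def)
    fix A fo rhs assume p: "(A, fo, rhs) \<in> P"
    then show "A \<in> NT" unfolding NT_def by force
    have "length rhs \<in> DL" unfolding DL_def using p by force
    from d[OF this] show "length rhs \<le> Suc d" by simp
    fix A' \<delta> assume "Nt A' \<delta> \<in> set rhs"
    with p have s: "Nt A' \<delta> \<in> R" unfolding R_def by force
    have "A' \<in> NT" unfolding NT_def using s by (force intro: rev_image_eqI)
    moreover have "set \<delta> \<subseteq> FR" unfolding FR_def using s by force
    moreover have "length \<delta> \<in> DL" unfolding DL_def using s by (force intro: rev_image_eqI)
    ultimately show "A' \<in> NT \<and> set \<delta> \<subseteq> insert bot FR \<and> length \<delta> < Suc d"
      using d[of "length \<delta>"] by auto
  qed (use bot in auto)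
  then show ?thesis by blast
qed

theorem theorem2:
  fixes L :: "'t list set" and A B :: "'t set"
  assumes "indexed_language L"
    and "L \<subseteq> lists A"
    and "B \<subseteq> A"
    and "rare B L"
  shows "nonfrequent B L"
proof -
  from assms(1) obtain P :: "(nat, nat, 't) iprod set" and S where P: "finite P" "L = ilang P S"
    unfolding indexed_language_def by blast
  from ex_finite_grammar[OF P(1)] obtain bot NT FL d where "finite_grammar P S bot NT FL d" by blast
  then interpret finite_grammar P B S bot NT FL d .
  \<comment> \<open>\<open>bot\<close> can be put below every derivation, and removed again because
    it is never popped.\<close>
  have L: "L = {w. der P [Nt S [bot]] w}"
    using der_inst[of P "[Nt S []]" _ "[bot]"] der_drop_bottom[OF bot_not_popped, of "[Nt S []]"]
    unfolding P(2) by (auto simp: ilang_iff_der)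
  from rare_imp_bounded assms(4) show ?thesis
    unfolding L nonfrequent_def by blast
qed

end
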